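(* For $n\ge1$, the number of permutations in $S_n$ equivalent to the identity $\iota_n=12\cdots n$ under adjacent $\{\{123,321\}\}$-equivalence is $\binom{n-1}{\lfloor (n-1)/2\rfloor}$.
   Context: Permutations are written as words $\pi_1\cdots\pi_n$. An adjacent move on $\pi\in S_n$ chooses three consecutive positions $i,i+1,i+2$ such that $\pi_i<\pi_{i+1}<\pi_{i+2}$ or $\pi_i>\pi_{i+1}>\pi_{i+2}$, and reverses these three entries (replaces $\pi_i\pi_{i+1}\pi_{i+2}$ by $\pi_{i+2}\pi_{i+1}\pi_i$), i.e., replaces pattern $123$ by $321$ or vice versa. Equivalence is the equivalence relation generated by such moves. *)

theory Defs
  imports "HOL-Combinatorics.Multiset_Permutations"
begin

inductive adjacent_move :: "nat list \<Rightarrow> nat list \<Rightarrow> bool" where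
  "a < b \<and> b < c \<or> a > b \<and> b > c \<Longrightarrow>
     adjacent_move (us @ [a, b, c] @ vs) (us @ [c, b, a] @ vs)"

text \<open>A move only rearranges entries, so generating the equivalence on all words and
  restricting it to the permutations of \<open>{1..n}\<close> is the same as generating it there.\<close>

definition adjacent_equiv :: "nat list \<Rightarrow> nat list \<Rightarrow> bool" where
  "adjacent_equiv = equivclp adjacent_move"

definition identity_word :: "nat \<Rightarrow> nat list" where
  "identity_word n = [1..<n + 1]"

end

theory Submission
  imports Defs
begin

text \<open>
  The words equivalent to the identity are exactly those produced by a left-to-right scan.
  Reading position \<open>i\<close> together with value \<open>i\<close>, keep a first-in-first-out queue of the positions
  still waiting for a value larger than \<open>i\<close>, and one of the values at most \<open>i\<close> still waiting for a
  position; both queues have the same length \<open>c\<close>. While \<open>c > 0\<close>, fixed points alternate with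
  non-fixed points, and each non-fixed point lets its position and its value independently join
  or leave a queue. Reversing a monotone triple only exchanges the scan steps at its two ends
  (the middle entry is always a fixed point) and leaves the rest of the scan alone, so these words
  are closed under moves. Conversely, the first step that serves a waiting value completes a
  decreasing triple, so the identity can be reached by moves that decrease the word
  lexicographically. Counting scans amounts to a two-step Pascal recursion in \<open>c\<close>.
\<close>

section \<open>Scans\<close>

definition lift :: "nat \<Rightarrow> nat \<Rightarrow> nat" where "lift m v = (if m < v then Suc v else v)"

text \<open>
  In \<open>gen w q act\<close> the word \<open>w\<close> is the scanned prefix, \<open>q\<close> the queue of values up to \<open>length w\<close>
  that do not occur in \<open>w\<close>, and \<open>act\<close> tells whether the next point may be non-fixed. A position
  waiting for a value carries a provisional letter: the letters exceeding \<open>length w\<close> are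
  \<open>length w + 1, \<dots>, length w + length q\<close>, from left to right. A step that does not assign the new
  value to the oldest waiting position therefore has to lift them by one.
\<close>

inductive gen :: "nat list \<Rightarrow> nat list \<Rightarrow> bool \<Rightarrow> bool" where
  Nil: "gen [] [] True"
| Fix: "gen w q act \<Longrightarrow> q = [] \<or> \<not> act \<Longrightarrow>
    gen (map (lift (length w)) w @ [length w + 1]) q True"
| Open: "gen w q True \<Longrightarrow>
    gen (map (lift (length w)) w @ [length w + length q + 2]) (q @ [length w + 1]) False"
| Upper: "gen w q True \<Longrightarrow> q \<noteq> [] \<Longrightarrow>
    gen (w @ [length w + length q + 1]) q False"
| Lower: "gen w (a # q) True \<Longrightarrow>
    gen (map (lift (length w)) w @ [a]) (q @ [length w + 1]) False"
| Close: "gen w (a # q) True \<Longrightarrow> act \<longleftrightarrow> q = [] \<Longrightarrow> gen (w @ [a]) q act"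

lemma lift_less_iff [simp]: "lift m u < lift m v \<longleftrightarrow> u < v"
  by (auto simp: lift_def)

lemma inj_lift: "inj (lift m)"
  by (auto simp: inj_def lift_def split: if_splits)

text \<open>A non-fixed step may just have queued the value \<open>length w\<close>, whereas after a
  fixed point every queued value is strictly smaller. This strictness later places served values
  below the fixed point before them.\<close>

lemma gen_bounds:
  assumes "gen w q act"
  shows "\<forall>v\<in>set w. v \<le> length w + length q"
    and "\<forall>v\<in>set q. v + (if act then 1 else 0) \<le> length w"
    and "\<not> act \<Longrightarrow> q \<noteq> []"
proof -
  have "(\<forall>v\<in>set w. v \<le> length w + length q) \<and> (\<forall>v\<in>set q. v + (if act then 1 else 0) \<le> length w)
    \<and> (\<not> act \<longrightarrow> q \<noteq> [])"
    using assms by induction (auto simp: lift_def le_Suc_eq Suc_le_eq split: if_splits)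
  then show "\<forall>v\<in>set w. v \<le> length w + length q"
    and "\<forall>v\<in>set q. v + (if act then 1 else 0) \<le> length w"
    and "\<not> act \<Longrightarrow> q \<noteq> []"
    by blast+
qed

lemma gen_map_lift_id:
  assumes "gen w [] act" "length w \<le> k"
  shows "map (lift k) w = w"
  using gen_bounds(1)[OF assms(1)] assms(2) by (auto simp: lift_def intro!: map_idI)

lemma gen_True_if_Nil: "gen w [] act \<Longrightarrow> act"
  using gen_bounds(3) by blast

section \<open>Invariance under moves\<close>

text \<open>Only \<open>Fix\<close> can end in this state: the non-fixed steps set the flag to
  \<open>False\<close>, except a \<open>Close\<close> that empties the queue.\<close>

lemma gen_fixed_last: "gen w q True \<Longrightarrow> q \<noteq> [] \<Longrightarrow> w \<noteq> [] \<and> last w = length w"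
  by (erule gen.cases) auto

section \<open>Two scan steps, the second one a fixed point\<close>

context
  fixes w q :: "nat list" and m :: nat
  assumes g: "gen w q True" and m: "length w = m"
begin

lemma gen_Fix_Fix: "q = [] \<Longrightarrow> gen (w @ [m + 1, m + 2]) [] True"
  using gen.Fix[OF gen.Fix[OF g]] g m by (simp add: gen_map_lift_id lift_def del: map_map)

lemma gen_Open_Fix:
  "gen (map (lift (m + 1)) (map (lift m) w) @ [m + length q + 3, m + 2]) (q @ [m + 1]) True"
  using gen.Fix[OF gen.Open[OF g]] m by (simp add: lift_def eval_nat_numeral)

lemma gen_Open_Fix_Nil: "q = [] \<Longrightarrow> gen (w @ [m + 3, m + 2]) [m + 1] True"
  using gen_Open_Fix g m by (simp add: gen_map_lift_id del: map_map)

lemma gen_Upper_Fix: "q \<noteq> [] \<Longrightarrow> gen (map (lift (m + 1)) w @ [m + length q + 2, m + 2]) q True"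
  using gen.Fix[OF gen.Upper[OF g]] m by (simp add: lift_def eval_nat_numeral)

lemma gen_Lower_Fix:
  assumes "q = a # p"
  shows "gen (map (lift (m + 1)) (map (lift m) w) @ [a, m + 2]) (p @ [m + 1]) True"
  using gen.Fix[OF gen.Lower[OF g[unfolded assms]]] m gen_bounds(2)[OF g] assms
  by (simp add: lift_def[of "Suc _" a])

lemma gen_Close_Fix:
  assumes "q = a # p"
  shows "gen (map (lift (m + 1)) w @ [a, m + 2]) p True"
  using gen.Fix[OF gen.Close[OF g[unfolded assms] refl]] m gen_bounds(2)[OF g] assms
  by (simp add: lift_def[of "Suc _" a])

end

text \<open>This inverts the last two steps. In \<open>upper\<close> and \<open>lower\<close> the
  last step is not \<open>Fix\<close>, and the recorded bounds contradict \<open>y\<close> being the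
  middle of a monotone triple, whichever step follows. The other cases are those where
  \<open>y\<close> is a fixed point.\<close>

lemma gen_last_two:
  assumes "gen (us @ [x, y]) q act"
  obtains (upper) "length us + 2 < y" "x < y" "\<not> act"
  | (lower) "y < length us + 2" "y < x" "\<not> act \<or> q = []"
  | (Fix_Fix) "gen us [] True" "act" "q = []" "x = length us + 1" "y = length us + 2"
  | (Open_Fix) w p where "gen w p True" "act"
     "us = map (lift (length w + 1)) (map (lift (length w)) w)"
     "q = p @ [length w + 1]" "x = length w + length p + 3" "y = length w + 2"
  | (Upper_Fix) w where "gen w q True" "q \<noteq> []" "act" "us = map (lift (length w + 1)) w"
     "x = length w + length q + 2" "y = length w + 2"
  | (Lower_Fix) w p where "gen w (x # p) True" "act"
     "us = map (lift (length w + 1)) (map (lift (length w)) w)"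
     "q = p @ [length w + 1]" "y = length w + 2"
  | (Close_Fix) w where "gen w (x # q) True" "act" "us = map (lift (length w + 1)) w"
     "y = length w + 2"
  using assms
proof cases
  case (Fix w b)
  then obtain vs v where w: "w = vs @ [v]"
    by (cases w rule: rev_cases) auto
  have us: "length us = length vs" "act" "y = length vs + 2"
    "us = map (lift (length vs + 1)) vs" "x = lift (length vs + 1) v"
    using Fix(1,2) w by auto
  from \<open>gen w q b\<close> show ?thesis
  proof cases
    case F: (Fix u b')
    \<comment> \<open>\<open>Fix\<close> leaves the flag \<open>True\<close>, so two fixed points in
      a row force an empty queue.\<close>
    then have "q = []" using \<open>q = [] \<or> \<not> b\<close> by auto
    with F have "gen u [] True" using gen_True_if_Nil by metis
    moreover have "us = u" using F w us gen_map_lift_id[OF \<open>gen u [] True\<close>] by simp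
    ultimately show ?thesis using Fix_Fix F w us \<open>q = []\<close> by (auto simp: lift_def)
  next
    case (Open u p)
    then show ?thesis using Open_Fix[of u p] w us by (auto simp: lift_def[of "Suc _"])
  next
    case Upper
    then show ?thesis using Upper_Fix[of vs] w us by (auto simp: lift_def[of "Suc _"])
  next
    case (Lower u a p)
    then show ?thesis using Lower_Fix[of u p] w us gen_bounds(2)[OF Lower(4)]
      by (auto simp: lift_def[of "Suc _" a])
  next
    case (Close u a)
    then show ?thesis using Close_Fix[of u] w us gen_bounds(2)[OF Close(2)]
      by (auto simp: lift_def[of "Suc _" a])
  qed (use w in auto)
next
  case (Open w q')
  then obtain vs v where "w = vs @ [v]"
    by (cases w rule: rev_cases) auto
  then show ?thesis using Open upper gen_bounds(1)[OF Open(4)] by (auto simp: lift_def)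
next
  case Upper
  then have "gen (us @ [x]) q True" by auto
  from gen_bounds(1)[OF this] Upper upper show ?thesis by auto
next
  case (Lower w a q')
  then obtain vs v where w: "w = vs @ [v]"
    by (cases w rule: rev_cases) auto
  then show ?thesis using Lower lower w gen_fixed_last[OF Lower(4)] gen_bounds(2)[OF Lower(4)]
    by (auto simp: lift_def)
next
  case (Close w a)
  have g: "gen w (a # q) True" by fact
  have w: "w = us @ [x]" "a = y" using Close by auto
  then show ?thesis using Close lower w gen_fixed_last[OF g] gen_bounds(2)[OF g] by (auto simp: lift_def)
qed auto

lemma length_eq_plus_2E:
  assumes "length w = m + 2"
  obtains vs x y where "w = vs @ [x, y]" "length vs = m"
proof -
  from assms obtain w' y where "w = w' @ [y]" "length w' = m + 1"
    by (cases w rule: rev_cases) auto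
  then show thesis using that by (cases w' rule: rev_cases) auto
qed

text \<open>
  A move acts on three steps \<open>X\<close>, \<open>Fix\<close>, \<open>Y\<close>: at the left end it exchanges \<open>Fix\<close> or \<open>Lower\<close> with
  \<open>Open\<close>, and \<open>Close\<close> with \<open>Upper\<close>; at the right end it exchanges \<open>Fix\<close> or \<open>Upper\<close> with \<open>Close\<close>, and
  \<open>Open\<close> with \<open>Lower\<close>. Where there is a choice, \<open>Fix\<close> is the case of an empty queue.
\<close>

lemma gen_last_move:
  assumes "gen (us @ [x, y, z]) q act" and mono: "x < y \<and> y < z \<or> x > y \<and> y > z"
  shows "gen (us @ [z, y, x]) q act"
proof -
  define m where "m = length us"
  show ?thesis
    using assms(1)
  proof cases
    case (Fix w b)
    have lw: "length w = m + 2" using arg_cong[OF Fix(1), of length] by (simp add: m_def)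
    then obtain vs x' y' where w: "w = vs @ [x', y']" "length vs = m"
      by (rule length_eq_plus_2E)
    have eqs: "us = map (lift (m + 2)) vs" "x = lift (m + 2) x'" "y = lift (m + 2) y'" "z = m + 3"
      using Fix(1) w by auto
    from \<open>gen w q b\<close>[unfolded w] show ?thesis
    proof (cases rule: gen_last_two)
      case Fix_Fix
      then show ?thesis
        using gen.Close[OF gen_Open_Fix_Nil[OF Fix_Fix(1) w(2) refl], of True] w eqs Fix
        by (simp add: gen_map_lift_id lift_def eval_nat_numeral del: map_map)
    next
      case (Close_Fix u)
      then have q: "q = []" using Fix by auto
      have "map (lift (m + 2)) w = w"
        using gen_map_lift_id Fix lw q by simp
      moreover have u: "length u = m" using Close_Fix w by simp
      ultimately show ?thesis
        using gen.Close[OF gen_Upper_Fix[OF Close_Fix(1) u list.distinct(2)], of True]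
          w eqs Fix q Close_Fix
        by (simp add: lift_def eval_nat_numeral del: map_map)
    qed (use Fix w eqs mono in \<open>auto simp: lift_def\<close>)
  next
    case (Open w q')
    have lw: "length w = m + 2" using arg_cong[OF Open(1), of length] by (simp add: m_def)
    then obtain vs x' y' where w: "w = vs @ [x', y']" "length vs = m"
      by (rule length_eq_plus_2E)
    have eqs: "us = map (lift (m + 2)) vs" "x = lift (m + 2) x'" "y = lift (m + 2) y'" "z = m + length q' + 4"
      using Open(1) w by auto
    from \<open>gen w q' True\<close>[unfolded w] show ?thesis
    proof (cases rule: gen_last_two)
      case Fix_Fix
      then show ?thesis
        using gen.Lower[OF gen_Open_Fix_Nil[OF Fix_Fix(1) w(2) refl]] w eqs Open
        by (simp add: gen_map_lift_id lift_def eval_nat_numeral del: map_map)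
    next
      case (Close_Fix u)
      moreover have u: "length u = m" using Close_Fix w by simp
      ultimately show ?thesis
        using gen.Lower[OF gen_Upper_Fix[OF Close_Fix(1) u list.distinct(2)]]
          w eqs Open gen_bounds(2)[OF Close_Fix(1)]
        by (simp add: lift_def eval_nat_numeral del: map_map)
    next
      case (Lower_Fix u p)
      moreover have u: "length u = m" using Lower_Fix w by simp
      ultimately show ?thesis
        using gen.Lower[OF gen_Open_Fix[OF Lower_Fix(1) u, unfolded append_Cons]]
          w eqs Open gen_bounds(2)[OF Lower_Fix(1)]
        by (simp add: lift_def eval_nat_numeral del: map_map)
    qed (use Open w eqs mono in \<open>auto simp: lift_def\<close>)
  next
    case Upper
    then have g: "gen (us @ [x, y]) q True" and z: "z = m + length q + 3"
      by (auto simp: m_def)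
    from g show ?thesis
    proof (cases rule: gen_last_two)
      case (Close_Fix u)
      moreover have u: "length u = m" using Close_Fix m_def by simp
      ultimately show ?thesis
        using gen.Close[OF gen_Upper_Fix[OF Close_Fix(1) u list.distinct(2)], of False] Upper z
        by (simp add: m_def eval_nat_numeral del: map_map)
    next
      case (Lower_Fix u p)
      moreover have u: "length u = m" using Lower_Fix m_def by simp
      ultimately show ?thesis
        using gen.Close[OF gen_Open_Fix[OF Lower_Fix(1) u, unfolded append_Cons], of False] Upper z
        by (simp add: m_def eval_nat_numeral del: map_map)
    qed (use Upper z m_def mono in auto)
  next
    case (Lower w a q')
    have lw: "length w = m + 2" using arg_cong[OF Lower(1), of length] by (simp add: m_def)
    then obtain vs x' y' where w: "w = vs @ [x', y']" "length vs = m"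
      by (rule length_eq_plus_2E)
    have eqs: "us = map (lift (m + 2)) vs" "x = lift (m + 2) x'" "y = lift (m + 2) y'" "z = a"
      using Lower(1) w by auto
    have a: "a < m + 2" using gen_bounds(2) Lower lw by fastforce
    from \<open>gen w (a # q') True\<close>[unfolded w] show ?thesis
    proof (cases rule: gen_last_two)
      case (Open_Fix u p)
      have u: "length u = m" using Open_Fix w by simp
      show ?thesis
      \<comment> \<open>Because the queue is first-in-first-out, \<open>a\<close> is the oldest
        value. If \<open>p\<close> is empty, it is \<open>m + 1\<close>, queued by
        \<open>Open\<close> itself, and becomes a fixed point; otherwise it was already waiting and
        \<open>Lower\<close> can serve it at the left end.\<close>
      proof (cases p)
        case Nil
        have g: "gen u [] True" using Open_Fix Nil by simp
        note id = gen_map_lift_id[OF g, unfolded u]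
        show ?thesis
          using gen.Open[OF gen_Fix_Fix[OF g u refl]] w eqs Lower Nil Open_Fix u
          by (simp add: id lift_def eval_nat_numeral del: map_map)
      next
        case (Cons a' p')
        then show ?thesis
          using gen.Open[OF gen_Lower_Fix[OF Open_Fix(1) u Cons]] w eqs Lower Open_Fix u a
          by (simp add: lift_def eval_nat_numeral del: map_map)
      qed
    next
      case (Upper_Fix u)
      have u: "length u = m" using Upper_Fix w by simp
      show ?thesis
        using gen.Open[OF gen_Close_Fix[OF Upper_Fix(1) u refl]] w eqs Lower Upper_Fix u a
        by (simp add: lift_def eval_nat_numeral del: map_map)
    qed (use Lower w eqs a mono gen_bounds(2) in \<open>fastforce simp: lift_def\<close>)+
  next
    case (Close w a)
    have w: "w = us @ [x, y]" "z = a" using Close(1) by auto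
    have g: "gen (us @ [x, y]) (a # q) True" using Close w by simp
    have a: "a < m + 2" using gen_bounds(2)[OF g] by (auto simp: m_def)
    have m: "length us = m" by (simp add: m_def)
    from g show ?thesis
    proof (cases rule: gen_last_two)
      case (Open_Fix u p)
      have u: "length u = m" using Open_Fix m_def by simp
      show ?thesis
      proof (cases p)
        case Nil
        have g: "gen u [] True" using Open_Fix Nil by simp
        note id = gen_map_lift_id[OF g, unfolded u]
        show ?thesis
          using gen.Fix[OF gen_Fix_Fix[OF g u refl]] w Close Nil Open_Fix u m
          by (simp add: id lift_def eval_nat_numeral del: map_map)
      next
        case (Cons a' p')
        then show ?thesis
          using gen.Upper[OF gen_Lower_Fix[OF Open_Fix(1) u Cons]] w Close Open_Fix u m
          by (simp add: eval_nat_numeral del: map_map)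
      qed
    next
      case (Upper_Fix u)
      have u: "length u = m" using Upper_Fix m_def by simp
      have g': "gen (us @ [a, m + 2]) q True"
        using gen_Close_Fix[OF Upper_Fix(1) u refl] Upper_Fix m by simp
      show ?thesis
      proof (cases "q = []")
        case True
        have "map (lift (m + 2)) (us @ [a, m + 2]) = us @ [a, m + 2]"
          by (rule gen_map_lift_id[where act = True]) (use g' True m in simp_all)
        then have "gen (us @ [a, m + 2, m + 3]) [] True"
          using gen.Fix[OF g'] True m by (simp add: eval_nat_numeral)
        then show ?thesis
          using True m Upper_Fix w Close by (simp add: eval_nat_numeral)
      next
        case False
        then show ?thesis
          using gen.Upper[OF g'] m Upper_Fix w Close by (simp add: eval_nat_numeral)
      qed
    qed (use w a mono m gen_bounds(2) in fastforce)+
  qed simp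
qed

text \<open>Since \<open>lift\<close> is strictly monotone, a move that avoids the last letter pulls
  back to the unlifted prefix.\<close>

lemma adjacent_move_snoc:
  assumes "adjacent_move (map (lift m) w @ [z]) w'"
  obtains v where "w' = map (lift m) v @ [z]" "adjacent_move w v" "length v = length w"
  | us x y where "map (lift m) w = us @ [x, y]" "w' = us @ [z, y, x]"
    "x < y \<and> y < z \<or> x > y \<and> y > z"
  using assms
proof cases
  case (1 a b c us vs)
  show ?thesis
  proof (cases vs rule: rev_cases)
    case Nil
    then show ?thesis using 1 that(2)[of us a b] by simp
  next
    case (snoc vs' z')
    then have "map (lift m) w = us @ a # b # c # vs'" "z' = z" using 1 by auto
    then obtain us1 a1 b1 c1 vs1 where w: "w = us1 @ [a1, b1, c1] @ vs1" "us = map (lift m) us1"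
      "a = lift m a1" "b = lift m b1" "c = lift m c1" "vs' = map (lift m) vs1"
      by (auto simp: map_eq_append_conv map_eq_Cons_conv)
    have "adjacent_move w (us1 @ [c1, b1, a1] @ vs1)"
      unfolding w by (rule adjacent_move.intros) (use 1 w in simp)
    then show ?thesis using that(1)[of "us1 @ [c1, b1, a1] @ vs1"] 1 w snoc \<open>z' = z\<close> by simp
  qed
qed

text \<open>A step depends on the prefix only through its length and queue, so moves inside the
  prefix pass through it; moves touching the last letter are handled by
  \<open>gen_last_move\<close>.\<close>

lemma gen_move:
  assumes "gen w q act" "adjacent_move w w'"
  shows "gen w' q act"
  using assms
proof (induction arbitrary: w')
  case Nil
  then show ?case by (auto elim: adjacent_move.cases)
next
  case (Fix w q act)
  from Fix.prems show ?case
  proof (cases rule: adjacent_move_snoc)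
    case (1 v)
    then show ?thesis using gen.Fix[OF Fix.IH] Fix.hyps by metis
  next
    case (2 us x y)
    then show ?thesis using gen.Fix[OF Fix.hyps] gen_last_move[of us x y] by simp
  qed
next
  case (Open w q)
  from Open.prems show ?case
  proof (cases rule: adjacent_move_snoc)
    case (1 v)
    then show ?thesis using gen.Open[OF Open.IH] by metis
  next
    case (2 us x y)
    then show ?thesis using gen.Open[OF Open.hyps] gen_last_move[of us x y] by simp
  qed
next
  case (Upper w q)
  \<comment> \<open>\<open>Upper\<close> does not lift the prefix. Lifting above its largest
    possible letter changes nothing, which brings the word into the form of
    \<open>adjacent_move_snoc\<close>.\<close>
  have id: "map (lift (length w + length q)) v = v" if "adjacent_move w v \<or> v = w" for v
  proof -
    have "set v = set w" using that by (auto elim!: adjacent_move.cases)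
    then show ?thesis using gen_bounds(1)[OF Upper.hyps(1)] by (metis lift_def map_idI not_less)
  qed
  from Upper.prems have "adjacent_move (map (lift (length w + length q)) w @ [length w + length q + 1]) w'"
    by (simp add: id)
  then show ?case
  proof (cases rule: adjacent_move_snoc)
    case (1 v)
    then show ?thesis using gen.Upper[OF Upper.IH] Upper.hyps id by metis
  next
    case (2 us x y)
    then show ?thesis using gen.Upper[OF Upper.hyps] id gen_last_move[of us x y] by simp
  qed
next
  case (Lower w a q)
  from Lower.prems show ?case
  proof (cases rule: adjacent_move_snoc)
    case (1 v)
    then show ?thesis using gen.Lower[OF Lower.IH] by metis
  next
    case (2 us x y)
    then show ?thesis using gen.Lower[OF Lower.hyps] gen_last_move[of us x y] by simp
  qed
next
  case (Close w a q act)
  have id: "map (lift (length w + length (a # q))) v = v" if "adjacent_move w v \<or> v = w" for v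
  proof -
    have "set v = set w" using that by (auto elim!: adjacent_move.cases)
    then show ?thesis using gen_bounds(1)[OF Close.hyps(1)] by (metis lift_def map_idI not_less)
  qed
  from Close.prems have "adjacent_move (map (lift (length w + length (a # q))) w @ [a]) w'"
    using id[of w] by simp
  then show ?case
  proof (cases rule: adjacent_move_snoc)
    case (1 v)
    then show ?thesis using gen.Close[OF Close.IH] Close.hyps id by metis
  next
    case (2 us x y)
    then show ?thesis using gen.Close[OF Close.hyps] id gen_last_move[of us x y] by simp
  qed
qed

section \<open>Reaching the identity\<close>

definition has_decreasing_triple :: "nat list \<Rightarrow> bool" where
  "has_decreasing_triple w \<longleftrightarrow> (\<exists>us a b c vs. w = us @ [c, b, a] @ vs \<and> a < b \<and> b < c)"

lemma has_decreasing_triple_append: "has_decreasing_triple w \<Longrightarrow> has_decreasing_triple (w @ xs)"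
  unfolding has_decreasing_triple_def by (metis append.assoc)

lemma has_decreasing_triple_map_lift: "has_decreasing_triple w \<Longrightarrow> has_decreasing_triple (map (lift m) w)"
  unfolding has_decreasing_triple_def map_eq_append_conv by (fastforce simp: map_eq_Cons_conv)

text \<open>The last three alternatives describe a scan that has served no waiting value.
  \<open>Lower\<close> and \<open>Close\<close> can only start from the last one, where the served
  value \<open>a < length w\<close> completes \<open>x\<close>, \<open>length w\<close>,
  \<open>a\<close>. An empty queue thus leaves only the identity or a decreasing triple.\<close>

lemma gen_descent:
  assumes "gen w q act"
  shows "has_decreasing_triple w
    \<or> q = [] \<and> w = [1..<length w + 1]
    \<or> q \<noteq> [] \<and> \<not> act \<and> (\<exists>us x. w = us @ [x] \<and> length w < x)
    \<or> q \<noteq> [] \<and> act \<and> (\<exists>us x. w = us @ [x, length w] \<and> length w < x)"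
  using assms
proof induction
  case Nil
  then show ?case by simp
next
  case (Fix w q act)
  consider "has_decreasing_triple w" | "q = []" "w = [1..<length w + 1]"
    | us x where "q \<noteq> []" "w = us @ [x]" "length w < x"
    using Fix by blast
  then show ?case
  proof cases
    case 1
    then show ?thesis using has_decreasing_triple_append has_decreasing_triple_map_lift by blast
  next
    case 2
    then have "map (lift (length w)) w = w" using gen_map_lift_id Fix by blast
    then show ?thesis using 2 by (metis length_append_singleton upt_Suc_append Suc_eq_plus1 le_add2)
  next
    case 3
    then show ?thesis by (auto simp: lift_def)
  qed
next
  case (Open w q)
  then show ?case by auto
next
  case (Upper w q)
  then show ?case using Upper.hyps by auto
next
  case (Lower w a q)
  from Lower.IH consider "has_decreasing_triple w" | us x where "w = us @ [x, length w]" "length w < x"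
    by blast
  then show ?case
  proof cases
    case 1
    then show ?thesis using has_decreasing_triple_append has_decreasing_triple_map_lift by blast
  next
    case 2
    have "map (lift (length w)) w = map (lift (length w)) us @ [Suc x, length w]"
      using arg_cong[OF 2(1), of "map (lift (length w))"] 2(2) by (simp add: lift_def)
    moreover have "a < length w" using gen_bounds(2)[OF Lower.hyps] by simp
    ultimately have "has_decreasing_triple (map (lift (length w)) w @ [a])"
      using 2(2) unfolding has_decreasing_triple_def
      by (intro exI[of _ "map (lift (length w)) us"] exI[of _ a] exI[of _ "length w"]
          exI[of _ "Suc x"] exI[of _ "[]"]) auto
    then show ?thesis by blast
  qed
next
  case (Close w a q)
  from Close.IH consider "has_decreasing_triple w" | us x where "w = us @ [x, length w]" "length w < x"
    by blast
  then show ?case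
  proof cases
    case 1
    then show ?thesis using has_decreasing_triple_append by blast
  next
    case 2
    have "a < length w" using gen_bounds(2)[OF Close.hyps(1)] by simp
    then have "has_decreasing_triple (w @ [a])"
      unfolding has_decreasing_triple_def
      by (intro exI[of _ us] exI[of _ a] exI[of _ "length w"] exI[of _ x] exI[of _ "[]"])
        (use 2(2) arg_cong[OF 2(1), of "\<lambda>l. l @ [a]"] in simp)
    then show ?thesis by blast
  qed
qed

lemma adjacent_move_sym: "adjacent_move v w \<Longrightarrow> adjacent_move w v"
  by (auto elim!: adjacent_move.cases intro!: adjacent_move.intros)

lemma gen_identity: "gen [1..<Suc n] [] True"
proof (induction n)
  case 0 show ?case using gen.Nil by simp
next
  case (Suc n)
  have "[1..<Suc (Suc n)] = [1..<Suc n] @ [Suc n]" by simp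
  then show ?case using gen.Fix[OF Suc] gen_map_lift_id[OF Suc, of n] by (simp del: upt_Suc)
qed

lemma gen_equiv_identity:
  assumes "gen w [] True"
  shows "adjacent_equiv (identity_word (length w)) w"
  \<comment> \<open>\<open>lex\<close> relates only words of equal length, hence is well-founded.
    Undoing a decreasing triple descends in it.\<close>
  using wf_lex[OF wf_less_than] assms
proof (induction w rule: wf_induct_rule)
  case (less w)
  show ?case
  proof (cases "has_decreasing_triple w")
    case True
    then obtain us a b c vs where w: "w = us @ [c, b, a] @ vs" "a < b" "b < c"
      unfolding has_decreasing_triple_def by blast
    define v where "v = us @ [a, b, c] @ vs"
    have "adjacent_move v w"
      unfolding v_def w(1) using w(2,3) by (intro adjacent_move.intros) simp
    moreover have "(v, w) \<in> lex less_than"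
      unfolding v_def w(1) using w(2,3) by (simp add: lex_append_left_iff)
    moreover have "gen v [] True"
      using gen_move[OF less.prems] adjacent_move_sym \<open>adjacent_move v w\<close> by blast
    ultimately show ?thesis
      using less.IH[of v] unfolding adjacent_equiv_def
      by (auto simp: v_def w(1) intro: equivclp_into_equivclp)
  next
    case False
    then show ?thesis using gen_descent[OF less.prems]
      by (simp add: identity_word_def adjacent_equiv_def)
  qed
qed

section \<open>The class of the identity as a set of scanned words\<close>

lemma adjacent_equiv_mset: "adjacent_equiv v w \<Longrightarrow> mset v = mset w"
  unfolding adjacent_equiv_def
  by (induction rule: equivclp_induct) (auto elim!: adjacent_move.cases)

lemma adjacent_equiv_identity_gen:
  "adjacent_equiv (identity_word n) w \<Longrightarrow> gen w [] True"
  unfolding adjacent_equiv_def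
  by (induction rule: equivclp_induct)
    (use gen_identity gen_move adjacent_move_sym in \<open>auto simp: identity_word_def\<close>)

lemma identity_class_eq_gen:
  "{\<pi> \<in> permutations_of_set {1..n}. adjacent_equiv (identity_word n) \<pi>} =
    {w. gen w [] True \<and> length w = n}"
proof (intro set_eqI iffI; clarsimp)
  fix w assume "w \<in> permutations_of_set {Suc 0..n}" "adjacent_equiv (identity_word n) w"
  then show "gen w [] True \<and> length w = n"
    using adjacent_equiv_identity_gen length_finite_permutations_of_set by fastforce
next
  fix w assume "gen w [] True" "n = length w"
  then have eq: "adjacent_equiv (identity_word n) w" using gen_equiv_identity by blast
  \<comment> \<open>That a scanned word is a permutation is inherited from the identity through the
    moves.\<close>
  have "mset w = mset [1..<n+1]" using adjacent_equiv_mset[OF eq] by (simp add: identity_word_def)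
  from mset_eq_setD[OF this] mset_eq_imp_distinct_iff[OF this]
  have "set w = {Suc 0..n}" "distinct w" by auto
  with eq show "w \<in> permutations_of_set {Suc 0..length w} \<and> adjacent_equiv (identity_word (length w)) w"
    by (simp add: permutations_of_set_def \<open>n = length w\<close>)
qed

section \<open>Counting scans\<close>

text \<open>The queue is kept in the state so that each kind of step becomes a function.\<close>

definition states :: "nat \<Rightarrow> nat \<Rightarrow> bool \<Rightarrow> (nat list \<times> nat list) set" where
  "states m c act = {(w, q). gen w q act \<and> length w = m \<and> length q = c}"

definition fix_step :: "nat list \<times> nat list \<Rightarrow> nat list \<times> nat list" where
  "fix_step = (\<lambda>(w, q). (map (lift (length w)) w @ [length w + 1], q))"

definition open_step :: "nat list \<times> nat list \<Rightarrow> nat list \<times> nat list" where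
  "open_step = (\<lambda>(w, q). (map (lift (length w)) w @ [length w + length q + 2], q @ [length w + 1]))"

definition upper_step :: "nat list \<times> nat list \<Rightarrow> nat list \<times> nat list" where
  "upper_step = (\<lambda>(w, q). (w @ [length w + length q + 1], q))"

definition lower_step :: "nat list \<times> nat list \<Rightarrow> nat list \<times> nat list" where
  "lower_step = (\<lambda>(w, q). (map (lift (length w)) w @ [hd q], tl q @ [length w + 1]))"

definition close_step :: "nat list \<times> nat list \<Rightarrow> nat list \<times> nat list" where
  "close_step = (\<lambda>(w, q). (w @ [hd q], tl q))"

lemmas step_defs = fix_step_def open_step_def upper_step_def lower_step_def close_step_def

lemma states_0: "states 0 c act = (if c = 0 \<and> act then {([], [])} else {})"
proof -
  have "q = [] \<and> act" if "gen [] q act" for q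
    using that by cases auto
  then show ?thesis using gen.Nil by (auto simp: states_def)
qed

lemma states_0_False: "states m 0 False = {}"
  using gen_bounds(3) by (auto simp: states_def)

lemma fix_step_states:
  "s \<in> states m c act \<Longrightarrow> c = 0 \<or> \<not> act \<Longrightarrow> fix_step s \<in> states (Suc m) c True"
  using gen.Fix[of "fst s" "snd s" act] by (auto simp: states_def fix_step_def)

lemma open_step_states: "s \<in> states m c True \<Longrightarrow> open_step s \<in> states (Suc m) (Suc c) False"
  using gen.Open[of "fst s" "snd s"] by (auto simp: states_def open_step_def)

lemma upper_step_states:
  "s \<in> states m (Suc c) True \<Longrightarrow> upper_step s \<in> states (Suc m) (Suc c) False"
  using gen.Upper[of "fst s" "snd s"]
  by (cases "snd s") (auto simp: states_def upper_step_def)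

lemma lower_step_states:
  "s \<in> states m (Suc c) True \<Longrightarrow> lower_step s \<in> states (Suc m) (Suc c) False"
  using gen.Lower[of "fst s" "hd (snd s)" "tl (snd s)"]
  by (cases "snd s") (auto simp: states_def lower_step_def)

lemma close_step_states:
  "s \<in> states m (Suc c) True \<Longrightarrow> close_step s \<in> states (Suc m) c (c = 0)"
  using gen.Close[of "fst s" "hd (snd s)" "tl (snd s)" "c = 0"]
  by (cases "snd s") (auto simp: states_def close_step_def)

lemma states_Suc_0_True:
  "states (Suc m) 0 True = fix_step ` states m 0 True \<union> close_step ` states m (Suc 0) True"
proof (intro equalityI subsetI)
  fix s assume "s \<in> states (Suc m) 0 True"
  then obtain w where s: "s = (w, [])" "gen w [] True" "length w = Suc m" by (auto simp: states_def)
  from s(2) show "s \<in> fix_step ` states m 0 True \<union> close_step ` states m (Suc 0) True"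
  proof cases
    case (Fix v act)
    then have "(v, []) \<in> states m 0 True"
      using s gen_True_if_Nil[of v act] by (auto simp: states_def)
    then show ?thesis using Fix s by (force simp: fix_step_def)
  next
    case (Close v a)
    then have "(v, [a]) \<in> states m (Suc 0) True"
      using s by (auto simp: states_def)
    then show ?thesis using Close s by (force simp: close_step_def)
  qed (use s in auto)
next
  fix s assume "s \<in> fix_step ` states m 0 True \<union> close_step ` states m (Suc 0) True"
  then show "s \<in> states (Suc m) 0 True"
    using fix_step_states[of _ m 0 True] close_step_states[of _ m 0] by auto
qed

lemma states_Suc_Suc_True:
  "states (Suc m) (Suc c) True = fix_step ` states m (Suc c) False"
proof (intro equalityI subsetI)
  fix s assume "s \<in> states (Suc m) (Suc c) True"
  then obtain w q where s: "s = (w, q)" "gen w q True" "length w = Suc m" "length q = Suc c"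
    by (auto simp: states_def)
  from s(2) show "s \<in> fix_step ` states m (Suc c) False"
  proof cases
    case (Fix v act)
    then have "(v, q) \<in> states m (Suc c) False"
      using s by (auto simp: states_def)
    then show ?thesis using Fix s by (force simp: fix_step_def)
  qed (use s in auto)
next
  fix s assume "s \<in> fix_step ` states m (Suc c) False"
  then show "s \<in> states (Suc m) (Suc c) True"
    using fix_step_states[of _ m "Suc c" False] by auto
qed

lemma states_Suc_Suc_False:
  "states (Suc m) (Suc c) False =
    (open_step ` states m c True \<union> upper_step ` states m (Suc c) True) \<union>
    (lower_step ` states m (Suc c) True \<union> close_step ` states m (Suc (Suc c)) True)" 
    (is "_ = ?R")
proof (intro equalityI subsetI)
  fix s assume "s \<in> states (Suc m) (Suc c) False"
  then obtain w q where s: "s = (w, q)" "gen w q False" "length w = Suc m" "length q = Suc c"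
    by (auto simp: states_def)
  from s(2) show "s \<in> ?R"
  proof cases
    case (Open v p)
    then have "(v, p) \<in> states m c True"
      using s by (auto simp: states_def)
    then show ?thesis using Open s by (force simp: open_step_def)
  next
    case (Upper v)
    then have "(v, q) \<in> states m (Suc c) True"
      using s by (auto simp: states_def)
    then show ?thesis using Upper s by (force simp: upper_step_def)
  next
    case (Lower v a p)
    then have "(v, a # p) \<in> states m (Suc c) True"
      using s by (auto simp: states_def)
    then show ?thesis using Lower s by (force simp: lower_step_def)
  next
    case (Close v a)
    then have "(v, a # q) \<in> states m (Suc (Suc c)) True"
      using s by (auto simp: states_def)
    then show ?thesis using Close s by (force simp: close_step_def)
  qed simp_all
next
  fix s assume "s \<in> ?R"
  then show "s \<in> states (Suc m) (Suc c) False"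
    using open_step_states[of _ m c] upper_step_states[of _ m c] lower_step_states[of _ m c]
      close_step_states[of _ m "Suc c"] by auto
qed

lemma finite_states: "finite (states m c act)"
proof (induction m arbitrary: c act)
  case 0
  then show ?case by (simp add: states_0)
next
  case (Suc m)
  then show ?case
    by (cases c; cases act)
      (simp_all add: states_0_False states_Suc_0_True states_Suc_Suc_True states_Suc_Suc_False)
qed

section \<open>Injectivity and disjointness of the steps, and the resulting recursion\<close>

lemma map_lift_eq_iff [simp]: "map (lift m) v = map (lift m) w \<longleftrightarrow> v = w"
  by (simp add: inj_map_eq_map inj_lift)

lemma inj_on_steps:
  shows "inj_on fix_step (states m c act)"
    and "inj_on open_step (states m c act)"
    and "inj_on upper_step (states m c act)"
    and "inj_on lower_step (states m (Suc c) act)"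
    and "inj_on close_step (states m (Suc c) act)"
proof -
  have hd_tl: "p = q" if "hd p = hd q" "tl p = tl q" "length p = Suc c" "length q = Suc c"
    for p q :: "nat list"
    using that by (cases p; cases q) simp_all
  show "inj_on fix_step (states m c act)" "inj_on open_step (states m c act)"
    "inj_on upper_step (states m c act)"
    by (rule inj_onI; simp add: states_def step_defs split_beta prod_eq_iff)+
  show "inj_on lower_step (states m (Suc c) act)" "inj_on close_step (states m (Suc c) act)"
    by (rule inj_onI; simp add: states_def step_defs split_beta prod_eq_iff hd_tl)+
qed

lemma card_states_Suc_0:
  "card (states (Suc m) 0 True) = card (states m 0 True) + card (states m (Suc 0) True)"
proof -
  \<comment> \<open>The last letters differ: \<open>m + 1\<close> against a served value below
    \<open>m\<close>.\<close>
  have "fix_step ` states m 0 True \<inter> close_step ` states m (Suc 0) True = {}"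
    by (auto simp: states_def step_defs length_Suc_conv dest!: gen_bounds(2))
  then show ?thesis
    by (simp add: states_Suc_0_True card_Un_disjoint finite_states card_image inj_on_steps)
qed

text \<open>With a nonempty queue the last step is \<open>Fix\<close> and the one before it is
  non-fixed, so the count advances two positions at a time.\<close>

lemma card_states_Suc_Suc:
  "card (states (Suc (Suc m)) (Suc c) True) =
    card (states m c True) + 2 * card (states m (Suc c) True) + card (states m (Suc (Suc c)) True)"
proof -
  let ?O = "open_step ` states m c True" and ?U = "upper_step ` states m (Suc c) True"
    and ?L = "lower_step ` states m (Suc c) True" and ?C = "close_step ` states m (Suc (Suc c)) True"
  \<comment> \<open>\<open>Open\<close> and \<open>Upper\<close> append the same letter here, but
    only \<open>Open\<close> puts \<open>m + 1\<close> into the queue. The same difference separates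
    \<open>Lower\<close> from \<open>Close\<close>.\<close>
  have "?O \<inter> ?U = {}"
    by (fastforce simp: states_def step_defs dest!: gen_bounds(2))
  moreover have "?L \<inter> ?C = {}"
    by (fastforce simp: states_def step_defs length_Suc_conv dest!: gen_bounds(2))
  moreover have "(?O \<union> ?U) \<inter> (?L \<union> ?C) = {}"
  proof -
    have "m < last (fst t)" if "t \<in> ?O \<union> ?U" for t
      using that by (auto simp: states_def step_defs)
    moreover have "last (fst t) \<le> m" if "t \<in> ?L \<union> ?C" for t
      using that by (auto simp: states_def step_defs length_Suc_conv dest!: gen_bounds(2))
    ultimately show ?thesis by (meson disjoint_iff leD)
  qed
  ultimately have "card (states (Suc m) (Suc c) False) =
      card (states m c True) + 2 * card (states m (Suc c) True) + card (states m (Suc (Suc c)) True)"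
    by (simp add: states_Suc_Suc_False card_Un_disjoint finite_states card_image inj_on_steps)
  then show ?thesis
    by (simp add: states_Suc_Suc_True card_image inj_on_steps)
qed

text \<open>The rule \<open>S\<close> is Pascal's rule applied twice, and passing from
  \<open>m\<close> to \<open>m + 2\<close> raises \<open>m div 2\<close> by one. Row 0 lies outside
  the closed form, hence the shift to \<open>Suc m\<close>.\<close>

lemma two_step_pascal_recursion:
  fixes H :: "nat \<Rightarrow> nat \<Rightarrow> nat"
  assumes "H 0 0 = 1" "\<And>c. H 0 (Suc c) = 0" "\<And>c. H 1 (Suc c) = 0"
    and 0: "\<And>m. H (Suc m) 0 = H m 0 + H m 1"
    and S: "\<And>m c. H (Suc (Suc m)) (Suc c) = H m c + 2 * H m (Suc c) + H m (Suc (Suc c))"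
  shows "H (Suc m) c = m choose (m div 2 + c)"
proof (induction m arbitrary: c rule: less_induct)
  case (less m)
  show ?case
  proof (cases c)
    case c: 0
    show ?thesis
    proof (cases m)
      case 0
      then show ?thesis using assms c by simp
    next
      case (Suc k)
      have "H (Suc m) c = (k choose (k div 2)) + (k choose (Suc (k div 2)))"
        using less[of k 0] less[of k 1] 0[of "Suc k"] Suc c by simp
      also have "\<dots> = m choose (Suc (k div 2))" using Suc by simp
      \<comment> \<open>For even \<open>k\<close> the number \<open>m\<close> is odd and the two
        central binomial coefficients agree; for odd \<open>k\<close> the lower indices
        coincide.\<close>
      also have "\<dots> = m choose (m div 2)"
      proof (cases "even k")
        case True
        then have "Suc (k div 2) \<le> m" "m - Suc (k div 2) = m div 2" using Suc by auto
        then show ?thesis by (metis binomial_symmetric)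
      next
        case False then show ?thesis using Suc by simp
      qed
      finally show ?thesis using c by simp
    qed
  next
    case c: (Suc d)
    show ?thesis
    proof (cases m)
      case 0
      then show ?thesis using assms c by simp
    next
      case m: (Suc k)
      show ?thesis
      \<comment> \<open>For \<open>m = 1\<close> the rule \<open>S\<close> reaches back to row 0,
        where the induction hypothesis says nothing, so the given values are used.\<close>
      proof (cases k)
        case 0
        then show ?thesis using assms(1,2) S[of 0 d] c m by (cases d) auto
      next
        case (Suc j)
        have "H (Suc m) c = (j choose (j div 2 + d)) +
            2 * (j choose (j div 2 + Suc d)) + (j choose (j div 2 + Suc (Suc d)))"
          unfolding c m Suc S using less[of j] m Suc by simp
        then show ?thesis using m Suc c by simp
      qed
    qed
  qed
qed

lemma card_states: "card (states (Suc m) c True) = m choose (m div 2 + c)"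
proof (rule two_step_pascal_recursion)
  show "card (states 1 (Suc c) True) = 0" for c
    by (simp add: states_0 states_Suc_Suc_True)
qed (simp_all add: states_0 card_states_Suc_0 card_states_Suc_Suc)

theorem theorem3p3:
  fixes n :: nat
  assumes "n \<ge> 1"
  shows "card {\<pi> \<in> permutations_of_set {1..n}. adjacent_equiv (identity_word n) \<pi>}
           = (n - 1) choose ((n - 1) div 2)"
proof -
  have "states n 0 True = (\<lambda>w. (w, [])) ` {w. gen w [] True \<and> length w = n}"
    by (auto simp: states_def)
  then have "card {w. gen w [] True \<and> length w = n} = card (states n 0 True)"
    by (simp add: card_image inj_on_def)
  also have "\<dots> = (n - 1) choose ((n - 1) div 2)"
    using card_states[of "n - 1" 0] assms by simp
  finally show ?thesis by (simp only: identity_class_eq_gen)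
qed

end
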